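(* Let $G=(V_G,E_G)$ be a simple graph with $V_G=\{1,\dots,n\}$ and $|E_G|\geq 2$, and let $\mathbb{K}$ be a field. Let $f\in I(G)$ be a nonzero homogeneous binomial of degree $d$. Then $f$ is not in the ideal of $\mathbb{K}[E_G]$ generated by the elements of $I(G)$ of degree less than $d$ if and only if $f$ is either of the form $t_e^2-t_\ell^2$ for some $e,\ell\in E_G$, or of the form $\mathbf{t}_J-\mathbf{t}_K$, where $J$ and $K$ are nonequivalent minimum cardinality $(T,p)$-joins for some $(T,p)\in\mathcal{T}_G$.
   Context: $\mathbb{K}[E_G]=\mathbb{K}[t_e: e\in E_G]$ is the (standard graded) polynomial ring with one variable for each edge of $G$; for $\alpha\in\mathbb{N}^{E_G}$ ($\mathbb{N}$ contains $0$), $\mathbf{t}^\alpha=\prod_{e}t_e^{\alpha(e)}$, and for $J\subseteq E_G$, $\mathbf{t}_J=\prod_{e\in J}t_e$. A binomial is an element of the form $\mathbf{t}^\alpha-\mathbf{t}^\beta$. Eulerian ideal: let $\varphi:\mathbb{K}[E_G]\to\mathbb{K}[x_1,\dots,x_n]$ be the $\mathbb{K}$-algebra homomorphism with $t_e\mapsto x_ix_j$ for every edge $e=\{i,j\}$. Then $I(G)=\varphi^{-1}\bigl((x_i^2-x_j^2 : i,j\in V_G)\bigr)$. Joins: for $J\subseteq E_G$ and $i\in V_G$, $\deg_J(i)$ is the number of edges in $J$ containing $i$. For $T\subseteq V_G$ and $p\in\mathbb{Z}_2=\mathbb{Z}/2\mathbb{Z}$, a $(T,p)$-join is a subset $J\subseteq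 E_G$ such that $T=\{v\in V_G:\deg_J(v)\text{ is odd}\}$ and $|J|+2\mathbb{Z}=p$. $\mathcal{T}_G$ is the set of all pairs $(T,p)$ for which a $(T,p)$-join exists. For $(T,p)\in\mathcal{T}_G$, $\mathcal{J}^*(T,p)$ denotes the set of all $(T,p)$-joins of minimum cardinality (among all $(T,p)$-joins). Equivalence: $J,K\in\mathcal{J}^*(T,p)$ are equivalent, written $J\sim K$, if there exist $r\ge 0$ and $L^0,L^1,\dots,L^r\in\mathcal{J}^*(T,p)$ with $L^0=J$, $L^r=K$ and $L^i\cap L^{i+1}\neq\emptyset$ for all $0\le i\le r-1$. *)

theory Defs
  imports "HOL-Library.Poly_Mapping" "HOL-Library.Z2"
begin

section \<open>Polynomials\<close>

text \<open>A polynomial is a finitely supported map from monomials to coefficients, and a monomial is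
  a finitely supported map from variables to exponents.  The polynomial ring in the variables
  indexed by a set \<open>A\<close> is the subring \<open>polys A\<close>.\<close>

type_synonym ('x, 'k) mpoly = "('x \<Rightarrow>\<^sub>0 nat) \<Rightarrow>\<^sub>0 'k"

definition polys :: "'x set \<Rightarrow> ('x, 'k::field) mpoly set" where
  "polys A = {f. \<forall>m \<in> Poly_Mapping.keys f. Poly_Mapping.keys m \<subseteq> A}"

definition monomial :: "('x \<Rightarrow>\<^sub>0 nat) \<Rightarrow> ('x, 'k::field) mpoly" where
  "monomial \<alpha> = Poly_Mapping.single \<alpha> 1"

definition var :: "'x \<Rightarrow> ('x, 'k::field) mpoly" where
  "var x = monomial (Poly_Mapping.single x 1)"

definition const :: "'k \<Rightarrow> ('x, 'k::field) mpoly" where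
  "const c = Poly_Mapping.single 0 c"

definition mono_degree :: "('x \<Rightarrow>\<^sub>0 nat) \<Rightarrow> nat" where
  "mono_degree m = (\<Sum>x \<in> Poly_Mapping.keys m. Poly_Mapping.lookup m x)"

text \<open>The zero polynomial gets degree \<open>0\<close>, which is harmless when only generators of an ideal are
  selected by their degree.\<close>

definition total_degree :: "('x, 'k::field) mpoly \<Rightarrow> nat" where
  "total_degree f = Max (insert 0 (mono_degree ` Poly_Mapping.keys f))"

definition homogeneous :: "nat \<Rightarrow> ('x, 'k::field) mpoly \<Rightarrow> bool" where
  "homogeneous d f \<longleftrightarrow> (\<forall>m \<in> Poly_Mapping.keys f. mono_degree m = d)"

definition binomial_in :: "'x set \<Rightarrow> ('x, 'k::field) mpoly \<Rightarrow> bool" where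
  "binomial_in A f \<longleftrightarrow> (\<exists>\<alpha> \<beta>. Poly_Mapping.keys \<alpha> \<subseteq> A \<and> Poly_Mapping.keys \<beta> \<subseteq> A \<and>
      f = monomial \<alpha> - monomial \<beta>)"

text \<open>The ideal generated by \<open>S\<close> in the subring \<open>R\<close>; for \<open>R = UNIV\<close> this is
  \<open>module.span (*) S\<close>, but the coefficients have to be restricted to \<open>R\<close> in general.\<close>

definition ideal_gen :: "'r::comm_ring_1 set \<Rightarrow> 'r set \<Rightarrow> 'r set" where
  "ideal_gen R S = {(\<Sum>a\<in>A. c a * a) | A c. finite A \<and> A \<subseteq> S \<and> c ` A \<subseteq> R}"


section \<open>Simple graphs and the Eulerian ideal\<close>

definition simple_graph :: "'v set \<Rightarrow> 'v set set \<Rightarrow> bool" where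
  "simple_graph V E \<longleftrightarrow> finite V \<and> (\<forall>e\<in>E. e \<subseteq> V \<and> card e = 2)"

text \<open>The homomorphism sending the variable of an edge to the product of the variables of its
  two endpoints; see the lemmas \<open>edge_hom_const\<close>, \<open>edge_hom_var\<close>, \<open>edge_hom_add\<close> and
  \<open>edge_hom_mult\<close> below.\<close>

definition edge_hom :: "('v set, 'k::field) mpoly \<Rightarrow> ('v, 'k) mpoly" where
  "edge_hom f = (\<Sum>m \<in> Poly_Mapping.keys f. const (Poly_Mapping.lookup f m) *
      (\<Prod>e \<in> Poly_Mapping.keys m. (\<Prod>v\<in>e. var v) ^ Poly_Mapping.lookup m e))"

definition eulerian_ideal :: "'v set \<Rightarrow> 'v set set \<Rightarrow> ('v set, 'k::field) mpoly set" where
  "eulerian_ideal V E = {f \<in> polys E.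
      edge_hom f \<in> ideal_gen (polys V) {var i ^ 2 - var j ^ 2 | i j. i \<in> V \<and> j \<in> V}}"

definition edge_prod :: "'v set set \<Rightarrow> ('v set, 'k::field) mpoly" where
  "edge_prod J = (\<Prod>e\<in>J. var e)"


section \<open>Joins\<close>

definition deg_in :: "'v set set \<Rightarrow> 'v \<Rightarrow> nat" where
  "deg_in J v = card {e \<in> J. v \<in> e}"

definition is_join :: "'v set \<Rightarrow> 'v set set \<Rightarrow> 'v set \<Rightarrow> bit \<Rightarrow> 'v set set \<Rightarrow> bool" where
  "is_join V E T p J \<longleftrightarrow>
     J \<subseteq> E \<and> T = {v \<in> V. odd (deg_in J v)} \<and> (of_nat (card J) :: bit) = p"

definition join_types :: "'v set \<Rightarrow> 'v set set \<Rightarrow> ('v set \<times> bit) set" where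
  "join_types V E = {(T, p). T \<subseteq> V \<and> (\<exists>J. is_join V E T p J)}"

definition min_joins :: "'v set \<Rightarrow> 'v set set \<Rightarrow> 'v set \<Rightarrow> bit \<Rightarrow> 'v set set set" where
  "min_joins V E T p = {J. is_join V E T p J \<and> (\<forall>K. is_join V E T p K \<longrightarrow> card J \<le> card K)}"

definition join_equiv ::
  "'v set \<Rightarrow> 'v set set \<Rightarrow> 'v set \<Rightarrow> bit \<Rightarrow> 'v set set \<Rightarrow> 'v set set \<Rightarrow> bool" where
  "join_equiv V E T p J K \<longleftrightarrow>
     (\<exists>(r::nat) L. (\<forall>i\<le>r. L i \<in> min_joins V E T p) \<and> L 0 = J \<and> L r = K \<and>
        (\<forall>i<r. L i \<inter> L (Suc i) \<noteq> {}))"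


section \<open>The edge homomorphism is the intended one\<close>

definition edge_mono :: "('v set \<Rightarrow>\<^sub>0 nat) \<Rightarrow> ('v, 'k::field) mpoly" where
  "edge_mono m = (\<Prod>e \<in> Poly_Mapping.keys m. (\<Prod>v\<in>e. var v) ^ Poly_Mapping.lookup m e)"

lemma edge_mono_superset:
  assumes "finite A" "Poly_Mapping.keys m \<subseteq> A"
  shows "edge_mono m = (\<Prod>e\<in>A. (\<Prod>v\<in>e. var v) ^ Poly_Mapping.lookup m e)"
  unfolding edge_mono_def
  by (rule prod.mono_neutral_left) (use assms in \<open>auto simp: in_keys_iff\<close>)

lemma edge_mono_add: "edge_mono (m + n) = edge_mono m * edge_mono n"
proof -
  let ?A = "Poly_Mapping.keys m \<union> Poly_Mapping.keys n"
  have "Poly_Mapping.keys (m + n) \<subseteq> ?A" by (rule Poly_Mapping.keys_add)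
  then show ?thesis
    by (simp add: edge_mono_superset[of ?A] lookup_add power_add prod.distrib)
qed

lemma edge_hom_superset:
  assumes "finite A" "Poly_Mapping.keys f \<subseteq> A"
  shows "edge_hom f = (\<Sum>m\<in>A. const (Poly_Mapping.lookup f m) * edge_mono m)"
  unfolding edge_hom_def edge_mono_def[symmetric]
  by (rule sum.mono_neutral_left) (use assms in \<open>auto simp: in_keys_iff const_def\<close>)

lemma edge_hom_single: "edge_hom (Poly_Mapping.single m c) = const c * edge_mono m"
  by (subst edge_hom_superset[of "{m}"]) auto

lemma edge_hom_const: "edge_hom (const c) = const c"
  by (subst (1) const_def, subst edge_hom_single) (simp add: edge_mono_def)

lemma edge_hom_var: "i \<noteq> j \<Longrightarrow> edge_hom (var {i, j}) = var i * var j"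
  by (simp add: var_def[of "{i, j}"] monomial_def edge_hom_single edge_mono_def const_def)

lemma edge_hom_add: "edge_hom (f + g) = edge_hom f + edge_hom g"
proof -
  let ?A = "Poly_Mapping.keys f \<union> Poly_Mapping.keys g"
  have "Poly_Mapping.keys (f + g) \<subseteq> ?A" by (rule Poly_Mapping.keys_add)
  then show ?thesis
    by (simp add: edge_hom_superset[of ?A] lookup_add const_def single_add distrib_right
        sum.distrib)
qed

lemma edge_hom_sum: "finite A \<Longrightarrow> edge_hom (\<Sum>a\<in>A. h a) = (\<Sum>a\<in>A. edge_hom (h a))"
  by (induction A rule: finite_induct) (simp_all add: edge_hom_add, simp add: edge_hom_def)

lemma edge_hom_mult: "edge_hom (f * g) = edge_hom f * edge_hom g"
proof -
  have expand: "(\<Sum>m\<in>Poly_Mapping.keys p. Poly_Mapping.single m (Poly_Mapping.lookup p m)) = p"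
    for p :: "('a set, 'b::field) mpoly"
    by (rule poly_mapping_eqI)
       (auto simp: lookup_sum lookup_single when_def in_keys_iff)
  have single: "edge_hom (Poly_Mapping.single m c * Poly_Mapping.single n d) =
      edge_hom (Poly_Mapping.single m c) * edge_hom (Poly_Mapping.single n d)"
    for m n :: "'a set \<Rightarrow>\<^sub>0 nat" and c d :: 'b
  proof -
    have "(const (c * d) :: ('a, 'b) mpoly) = const c * const d"
      by (simp add: const_def mult_single)
    then show ?thesis
      by (simp add: mult_single edge_hom_single edge_mono_add mult_ac)
  qed
  have "edge_hom (f * g) = edge_hom
     ((\<Sum>m\<in>Poly_Mapping.keys f. Poly_Mapping.single m (Poly_Mapping.lookup f m)) *
      (\<Sum>n\<in>Poly_Mapping.keys g. Poly_Mapping.single n (Poly_Mapping.lookup g n)))"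
    by (simp only: expand)
  also have "\<dots> = edge_hom
      (\<Sum>m\<in>Poly_Mapping.keys f. Poly_Mapping.single m (Poly_Mapping.lookup f m)) * edge_hom
      (\<Sum>n\<in>Poly_Mapping.keys g. Poly_Mapping.single n (Poly_Mapping.lookup g n))"
    by (simp add: sum_product edge_hom_sum single)
  finally show ?thesis by (simp only: expand)
qed

end

theory Submission
  imports Defs
begin

text \<open>
  Modulo the differences \<open>x\<^sub>i\<^sup>2 - x\<^sub>j\<^sup>2\<close> a monomial in the vertex variables is determined by
  its degree and by the set of variables that occur in it to an odd power.  Hence the Eulerian
  ideal is governed by the \<^emph>\<open>type\<close> (\<open>edge_type\<close>) of a monomial in the edge variables, namely this
  pair of data for its image: a polynomial in the ideal has coefficient sum zero over all
  monomials of any given type (\<open>eulerian_coeff_sum_eq_0\<close>), and the difference of two monomials of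
  the same type lies in the ideal (\<open>monomial_diff_mem_eulerian_ideal\<close>).

  Call two monomials of the same type adjacent if they share a variable, and linked if a chain
  of adjacent monomials joins them.  The difference of two adjacent monomials is a variable times
  an element of the ideal of smaller degree, and telescoping along a chain shows that differences
  of linked monomials are generated in smaller degree.  Conversely, the sum of the coefficients
  over the monomials linked to a fixed monomial \<open>a\<close> of degree \<open>d\<close> vanishes on everything that is
  generated in degree less than \<open>d\<close>: multiplying by a nontrivial monomial \<open>c\<close> turns any two
  monomials of the same type into adjacent ones, so the \<open>m\<close> with \<open>c m\<close> linked to \<open>a\<close> form a union
  of types; and for \<open>c = 1\<close> the degree is too small for any contribution.  So the question
  becomes which pairs of monomials of the same type are not linked.

  If some monomial of the given type is \<open>t\<^sub>e\<^sup>2 g\<close> with \<open>g \<noteq> 1\<close>, then so is \<open>t\<^sub>l\<^sup>2 g\<close> for every edge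
  \<open>l\<close>.  All of these share the variables of \<open>g\<close>, and choosing \<open>l\<close> in the support of a given
  monomial links that monomial to them, so any two monomials of this type are linked
  (\<open>linked_to_double_plus\<close>).  If \<open>t\<^sub>e\<^sup>2\<close> itself has the type, then simplicity of the graph forces all
  monomials of this type to be squares of variables, and distinct squares share no variable.  In
  the remaining case all monomials of the type are squarefree.  The edges with odd exponent in a
  monomial form a join of the same kind, of smaller cardinality unless the monomial is squarefree,
  and a join with too few edges can be filled up by an even power of an edge; therefore the
  squarefree case is exactly that of minimum joins (\<open>min_join_iff_squarefree\<close>), and being linked
  is equivalence of joins (\<open>linked_indicators_iff\<close>).
\<close>

abbreviation (input) keys where "keys \<equiv> Poly_Mapping.keys"
abbreviation (input) lookup where "lookup \<equiv> Poly_Mapping.lookup"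
abbreviation (input) single where "single \<equiv> Poly_Mapping.single"


section \<open>Exponent vectors\<close>

lemma keys_add_nat: "keys (a + b) = keys a \<union> keys b" for a b :: "'x \<Rightarrow>\<^sub>0 nat"
  by (auto simp: in_keys_iff lookup_add)

lemma mono_degree_superset:
  assumes "finite A" "keys m \<subseteq> A"
  shows "mono_degree m = (\<Sum>x\<in>A. lookup m x)"
  unfolding mono_degree_def
  by (rule sum.mono_neutral_left) (use assms in \<open>auto simp: in_keys_iff\<close>)

lemma mono_degree_add: "mono_degree (a + b) = mono_degree a + mono_degree b"
  by (simp add: mono_degree_superset[of "keys a \<union> keys b"] keys_add_nat lookup_add sum.distrib)

lemma mono_degree_single [simp]: "mono_degree (single x k) = k"
  by (subst mono_degree_superset[of "{x}"]) auto

lemma mono_degree_zero [simp]: "mono_degree 0 = 0"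
  by (simp add: mono_degree_def)

lemma obtain_key:
  assumes "mono_degree m \<noteq> 0"
  obtains x where "x \<in> keys m"
  using assms by (auto simp: mono_degree_def)

lemma mono_degree_eq_0_iff: "mono_degree m = 0 \<longleftrightarrow> m = 0"
  by (auto simp: mono_degree_def in_keys_iff intro!: poly_mapping_eqI)

lemma mono_degree_sum: "mono_degree (\<Sum>a\<in>A. h a) = (\<Sum>a\<in>A. mono_degree (h a))"
  by (induction A rule: infinite_finite_induct) (simp_all add: mono_degree_add)

lemma split_off_power:
  fixes m :: "'x \<Rightarrow>\<^sub>0 nat"
  assumes "k \<le> lookup m x"
  obtains m' where "m = single x k + m'"
proof
  show "m = single x k + (m - single x k)"
    using assms by (intro poly_mapping_eqI)
      (auto simp: lookup_add lookup_minus lookup_single when_def)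
qed


section \<open>Sums of coefficients over sets of monomials\<close>

text \<open>These linear functionals, for suitable sets \<open>P\<close> of monomials, serve to show that a
  polynomial does not belong to an ideal.\<close>

definition coeff_sum :: "(('x \<Rightarrow>\<^sub>0 nat) \<Rightarrow> bool) \<Rightarrow> ('x, 'k::field) mpoly \<Rightarrow> 'k" where
  "coeff_sum P g = (\<Sum>m\<in>keys g. if P m then lookup g m else 0)"

lemma coeff_sum_superset:
  assumes "finite A" "keys g \<subseteq> A"
  shows "coeff_sum P g = (\<Sum>m\<in>A. if P m then lookup g m else 0)"
  unfolding coeff_sum_def
  by (rule sum.mono_neutral_left) (use assms in \<open>auto simp: in_keys_iff\<close>)

lemma coeff_sum_single: "coeff_sum P (single m c) = (if P m then c else 0)"
  by (subst coeff_sum_superset[of "{m}"]) auto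

lemma coeff_sum_zero [simp]: "coeff_sum P 0 = 0"
  by (simp add: coeff_sum_def)

lemma coeff_sum_add: "coeff_sum P (f + g) = coeff_sum P f + coeff_sum P g"
proof -
  have "keys (f + g) \<subseteq> keys f \<union> keys g" by (rule Poly_Mapping.keys_add)
  then show ?thesis
    by (auto simp: coeff_sum_superset[of "keys f \<union> keys g"] lookup_add sum.distrib[symmetric]
        intro!: sum.cong)
qed

lemma coeff_sum_diff: "coeff_sum P (f - g) = coeff_sum P f - coeff_sum P g"
  using coeff_sum_add[of P "f - g" g] by simp

lemma coeff_sum_sum: "coeff_sum P (\<Sum>a\<in>A. h a) = (\<Sum>a\<in>A. coeff_sum P (h a))"
  by (induction A rule: infinite_finite_induct) (simp_all add: coeff_sum_add)

lemma polynomial_expand: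
  "g = (\<Sum>m\<in>keys g. single m (lookup g m))" for g :: "('x, 'k::field) mpoly"
  by (rule poly_mapping_eqI) (auto simp: lookup_sum lookup_single when_def in_keys_iff)

lemma coeff_sum_mult:
  "coeff_sum P (h * g) = (\<Sum>c\<in>keys h. lookup h c * coeff_sum (\<lambda>m. P (c + m)) g)"
proof -
  have "h * g = (\<Sum>c\<in>keys h. \<Sum>m\<in>keys g. single (c + m) (lookup h c * lookup g m))"
    by (subst (1) polynomial_expand[of h], subst (1) polynomial_expand[of g])
       (simp add: sum_product mult_single)
  moreover have "lookup h c * coeff_sum (\<lambda>m. P (c + m)) g
      = (\<Sum>m\<in>keys g. coeff_sum P (single (c + m) (lookup h c * lookup g m)))" for c
    unfolding coeff_sum_single unfolding coeff_sum_def sum_distrib_left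
    by (intro sum.cong) auto
  ultimately show ?thesis by (simp add: coeff_sum_sum)
qed

text \<open>A multiple of a generator is a combination of its translates by monomials, and the
  coefficient sum of a translate is the coefficient sum of the generator over a translated set.\<close>

lemma coeff_sum_ideal_gen:
  assumes "g \<in> ideal_gen (polys A) S"
    and "\<And>a c. a \<in> S \<Longrightarrow> keys c \<subseteq> A \<Longrightarrow> coeff_sum (\<lambda>m. P (c + m)) a = 0"
  shows "coeff_sum P g = 0"
proof -
  obtain B c where g: "g = (\<Sum>a\<in>B. c a * a)" and B: "B \<subseteq> S" "c ` B \<subseteq> polys A"
    using assms(1) by (auto simp: ideal_gen_def)
  have "coeff_sum P (c a * a) = 0" if "a \<in> B" for a
    unfolding coeff_sum_mult
    by (rule sum.neutral) (use that B assms(2)[of a] in \<open>auto simp: polys_def image_subset_iff\<close>)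
  then show ?thesis by (simp add: g coeff_sum_sum)
qed

text \<open>Grouping the terms of \<open>g\<close> by their value under \<open>t\<close>, each group satisfies \<open>P\<close> entirely or not
  at all.\<close>

lemma coeff_sum_union_of_fibres:
  assumes "\<And>c. coeff_sum (\<lambda>m. t m = c) g = 0"
    and "\<And>m m'. m \<in> keys g \<Longrightarrow> m' \<in> keys g \<Longrightarrow> t m = t m' \<Longrightarrow> P m \<Longrightarrow> P m'"
  shows "coeff_sum P g = 0"
proof -
  have "coeff_sum P g =
      (\<Sum>c\<in>t ` keys g. \<Sum>m | m \<in> keys g \<and> t m = c. if P m then lookup g m else 0)"
    unfolding coeff_sum_def by (rule sum.image_gen) simp
  also have "\<dots> = 0"
  proof (rule sum.neutral, clarify)
    fix m0 assume m0: "m0 \<in> keys g"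
    show "(\<Sum>m | m \<in> keys g \<and> t m = t m0. if P m then lookup g m else 0) = 0"
    proof (cases "P m0")
      case True
      have "(\<Sum>m | m \<in> keys g \<and> t m = t m0. if P m then lookup g m else 0)
          = (\<Sum>m | m \<in> keys g \<and> t m = t m0. lookup g m)"
        using assms(2)[OF m0] True by (intro sum.cong) auto
      also have "\<dots> = coeff_sum (\<lambda>m. t m = t m0) g"
        by (simp add: coeff_sum_def sum.inter_filter)
      finally show ?thesis by (simp add: assms(1))
    next
      case False
      have "\<not> P m" if "m \<in> keys g" "t m = t m0" for m
        using assms(2)[OF that(1) m0 that(2)] False by blast
      then show ?thesis by (intro sum.neutral) auto
    qed
  qed
  finally show ?thesis .
qed


section \<open>Generated ideals and monomials\<close>

lemma polys_0 [simp]: "0 \<in> polys A"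
  by (simp add: polys_def)

lemma polys_1 [simp]: "1 \<in> polys A"
  by (simp add: polys_def)

lemma polys_add: "f \<in> polys A \<Longrightarrow> g \<in> polys A \<Longrightarrow> f + g \<in> polys A"
  using Poly_Mapping.keys_add[of f g] by (auto simp: polys_def)

lemma polys_mult: "f \<in> polys A \<Longrightarrow> g \<in> polys A \<Longrightarrow> f * g \<in> polys A"
  using Poly_Mapping.keys_mult[of f g] by (fastforce simp: polys_def keys_add_nat)

lemma polys_monomial: "keys m \<subseteq> A \<Longrightarrow> monomial m \<in> polys A"
  by (simp add: polys_def monomial_def)

lemma polys_monomial_diff:
  "keys a \<subseteq> A \<Longrightarrow> keys b \<subseteq> A \<Longrightarrow> (monomial a - monomial b :: ('x, 'k::field) mpoly) \<in> polys A"
  using keys_diff[of "monomial a" "monomial b"] by (auto simp: polys_def monomial_def)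

lemma ideal_gen_0: "0 \<in> ideal_gen R S"
  unfolding ideal_gen_def by (intro CollectI exI[of _ "{}"]) auto

lemma ideal_gen_generator: "a \<in> S \<Longrightarrow> a \<in> ideal_gen (polys A) S"
  unfolding ideal_gen_def by (intro CollectI exI[of _ "{a}"] exI[of _ "\<lambda>_. 1"]) auto

lemma ideal_gen_add:
  assumes "x \<in> ideal_gen (polys A) S" "y \<in> ideal_gen (polys A) S"
  shows "x + y \<in> ideal_gen (polys A) S"
proof -
  obtain B c where x: "x = (\<Sum>a\<in>B. c a * a)" "finite B" "B \<subseteq> S" "c ` B \<subseteq> polys A"
    using assms(1) by (auto simp: ideal_gen_def)
  obtain C d where y: "y = (\<Sum>a\<in>C. d a * a)" "finite C" "C \<subseteq> S" "d ` C \<subseteq> polys A"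
    using assms(2) by (auto simp: ideal_gen_def)
  define e where "e a = (if a \<in> B then c a else 0) + (if a \<in> C then d a else 0)" for a
  have "x = (\<Sum>a\<in>B \<union> C. (if a \<in> B then c a else 0) * a)"
    unfolding x(1) by (rule sum.mono_neutral_cong_left) (use x y in auto)
  moreover have "y = (\<Sum>a\<in>B \<union> C. (if a \<in> C then d a else 0) * a)"
    unfolding y(1) by (rule sum.mono_neutral_cong_left) (use x y in auto)
  ultimately have "x + y = (\<Sum>a\<in>B \<union> C. e a * a)"
    by (simp add: e_def distrib_right sum.distrib)
  moreover have "e ` (B \<union> C) \<subseteq> polys A"
    using x(4) y(4) by (auto simp: e_def image_subset_iff intro!: polys_add)
  ultimately show ?thesis
    unfolding ideal_gen_def using x y by (intro CollectI exI[of _ "B \<union> C"] exI[of _ e]) auto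
qed

lemma ideal_gen_mult:
  assumes "r \<in> polys A" "x \<in> ideal_gen (polys A) S"
  shows "r * x \<in> ideal_gen (polys A) S"
proof -
  obtain B c where x: "x = (\<Sum>a\<in>B. c a * a)" "finite B" "B \<subseteq> S" "c ` B \<subseteq> polys A"
    using assms(2) by (auto simp: ideal_gen_def)
  have "r * x = (\<Sum>a\<in>B. (r * c a) * a)"
    by (simp add: x sum_distrib_left mult.assoc)
  then show ?thesis
    unfolding ideal_gen_def using x assms(1)
    by (intro CollectI exI[of _ B] exI[of _ "\<lambda>a. r * c a"]) (auto intro!: polys_mult)
qed

lemma monomial_add: "monomial (a + b) = monomial a * monomial b"
  by (simp add: monomial_def mult_single)

lemma monomial_zero: "monomial 0 = 1"
  by (simp add: monomial_def)

lemma monomial_sum: "monomial (\<Sum>a\<in>A. h a) = (\<Prod>a\<in>A. monomial (h a))"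
  by (induction A rule: infinite_finite_induct) (simp_all add: monomial_add monomial_zero)

lemma monomial_single: "monomial (single x k) = var x ^ k"
proof (induction k)
  case (Suc k)
  have "single x (Suc k) = single x 1 + single x k"
    by (simp add: single_add[symmetric])
  then show ?case by (simp only: monomial_add Suc var_def power_Suc)
qed (simp add: monomial_zero)

lemma keys_monomial_diff:
  "a \<noteq> b \<Longrightarrow> keys (monomial a - monomial b :: ('x, 'k::field) mpoly) = {a, b}"
  by (auto simp: in_keys_iff monomial_def lookup_minus lookup_single when_def split: if_splits)


section \<open>Monomial differences modulo the differences of squares\<close>

text \<open>This is a complete invariant of monomials modulo the differences of squares.\<close>

definition parity_type :: "('x \<Rightarrow>\<^sub>0 nat) \<Rightarrow> nat \<times> 'x set" where
  "parity_type a = (mono_degree a, {v. odd (lookup a v)})"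

lemma parity_type_add_cancel [simp]:
  "parity_type (c + a) = parity_type (c + b) \<longleftrightarrow> parity_type a = parity_type b"
  by (auto simp: parity_type_def mono_degree_add lookup_add set_eq_iff)

definition square_diffs :: "'v set \<Rightarrow> ('v, 'k::field) mpoly set" where
  "square_diffs V = {var i ^ 2 - var j ^ 2 | i j. i \<in> V \<and> j \<in> V}"

lemma coeff_sum_parity_type_eq_0:
  assumes "g \<in> ideal_gen (polys V) (square_diffs V)"
  shows "coeff_sum (\<lambda>m. parity_type m = t) g = 0"
proof (rule coeff_sum_ideal_gen[OF assms])
  fix a :: "('a, 'b) mpoly" and c assume "a \<in> square_diffs V"
  then obtain i j where a: "a = single (single i 2) 1 - single (single j 2) 1"
    by (auto simp: square_diffs_def monomial_single[symmetric] monomial_def)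
  have "parity_type (single i (2::nat)) = parity_type (single j 2)"
    by (auto simp: parity_type_def lookup_single when_def)
  then have "parity_type (c + single i 2) = parity_type (c + single j 2)" by simp
  then show "coeff_sum (\<lambda>m. parity_type (c + m) = t) a = 0"
    by (simp only: a coeff_sum_diff coeff_sum_single) simp
qed

text \<open>Modulo differences of squares, the square of a monomial may be traded, one variable at a
  time, for a power of one fixed variable.  This brings every monomial to a normal form that
  depends on its parity type only.\<close>

lemma squares_to_power:
  assumes "keys q \<subseteq> V" "i \<in> V"
  shows "(monomial (q + q) - monomial (single i (2 * mono_degree q)) :: ('v, 'k::field) mpoly)
    \<in> ideal_gen (polys V) (square_diffs V)"
  using assms(1)
proof (induction "mono_degree q" arbitrary: q)
  case 0
  then have "q = 0" by (simp add: mono_degree_eq_0_iff)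
  then show ?case by (simp add: ideal_gen_0)
next
  case (Suc k)
  then obtain j where j: "j \<in> keys q"
    using obtain_key[of q] by auto
  then obtain r where q: "q = single j 1 + r"
    using split_off_power[of 1 q j] by (auto simp: in_keys_iff)
  have r: "k = mono_degree r" "keys r \<subseteq> V" "j \<in> V"
    using Suc.hyps(2) Suc.prems j by (auto simp: q mono_degree_add keys_add_nat)
  have "q + q = single j 2 + (r + r)"
    by (rule poly_mapping_eqI) (simp add: q lookup_add lookup_single when_def)
  moreover have "single i (2 * mono_degree q) = single i 2 + single i (2 * k)"
    using r by (simp add: q mono_degree_add single_add[symmetric])
  ultimately have "(monomial (q + q) - monomial (single i (2 * mono_degree q)) :: ('v, 'k) mpoly)
    = monomial (single j 2) * (monomial (r + r) - monomial (single i (2 * k)))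
      + monomial (single i (2 * k)) * (var j ^ 2 - var i ^ 2)"
    by (simp add: monomial_add monomial_single[symmetric] algebra_simps)
  also have "\<dots> \<in> ideal_gen (polys V) (square_diffs V)"
  proof (intro ideal_gen_add ideal_gen_mult)
    show "(monomial (r + r) - monomial (single i (2 * k)) :: ('v, 'k) mpoly) \<in> ideal_gen (polys V) (square_diffs V)"
      using Suc.hyps(1)[OF r(1,2)] r(1) by simp
    show "var j ^ 2 - var i ^ 2 \<in> ideal_gen (polys V) (square_diffs V)"
      using r(3) assms(2) by (intro ideal_gen_generator) (auto simp: square_diffs_def)
  qed (use r assms(2) in \<open>auto intro!: polys_monomial split: if_splits\<close>)
  finally show ?case .
qed

lemma parity_halves:
  fixes a :: "'x \<Rightarrow>\<^sub>0 nat"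
  obtains q r where "a = q + q + r" "keys q \<subseteq> keys a" "\<And>v. lookup r v = lookup a v mod 2"
proof -
  define q where "q = Poly_Mapping.map (\<lambda>n. n div 2) a"
  define r where "r = Poly_Mapping.map (\<lambda>n. n mod 2) a"
  have q: "lookup q v = lookup a v div 2" and r: "lookup r v = lookup a v mod 2" for v
    by (auto simp: q_def r_def Poly_Mapping.map.rep_eq when_def)
  show thesis
  proof
    show "a = q + q + r"
      by (rule poly_mapping_eqI) (simp add: lookup_add q r, presburger)
    show "keys q \<subseteq> keys a" by (auto simp: in_keys_iff q)
  qed (rule r)
qed

lemma monomial_diff_mem_square_diffs:
  assumes "keys a \<subseteq> V" "keys b \<subseteq> V" "parity_type a = parity_type b"
  shows "(monomial a - monomial b :: ('v, 'k::field) mpoly) \<in> ideal_gen (polys V) (square_diffs V)"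
proof (cases "V = {}")
  case True
  then have "a = 0" "b = 0" using assms by (auto simp: mono_degree_eq_0_iff[symmetric] mono_degree_def)
  then show ?thesis by (simp add: ideal_gen_0)
next
  case False
  then obtain i where i: "i \<in> V" by blast
  obtain q r where a: "a = q + q + r" "keys q \<subseteq> keys a" "\<And>v. lookup r v = lookup a v mod 2"
    using parity_halves[of a] by blast
  obtain q' r' where b: "b = q' + q' + r'" "keys q' \<subseteq> keys b" "\<And>v. lookup r' v = lookup b v mod 2"
    using parity_halves[of b] by blast
  have "lookup a v mod 2 = lookup b v mod 2" for v
    using assms(3) by (auto simp: parity_type_def set_eq_iff mod2_eq_if)
  then have r: "r' = r" by (intro poly_mapping_eqI) (simp add: a(3) b(3))
  have "2 * mono_degree q = 2 * mono_degree q'"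
  proof -
    have "mono_degree a = 2 * mono_degree q + mono_degree r"
      by (subst a(1)) (simp add: mono_degree_add)
    moreover have "mono_degree b = 2 * mono_degree q' + mono_degree r"
      by (subst b(1)) (simp add: mono_degree_add r)
    ultimately show ?thesis using assms(3) by (simp add: parity_type_def)
  qed
  moreover define N where "N = 2 * mono_degree q"
  ultimately have N: "2 * mono_degree q = N" "2 * mono_degree q' = N" by auto
  have qV: "keys q \<subseteq> V" "keys q' \<subseteq> V" using a(2) b(2) assms by auto
  have rV: "keys r \<subseteq> V" using assms(1) a(3) by (auto simp: in_keys_iff subset_iff)
  have "monomial a - monomial b = monomial r * (monomial (q + q) - monomial (single i N))
      + monomial r * ((- 1) * (monomial (q' + q') - monomial (single i N)) :: ('v, 'k) mpoly)"
    by (subst a(1), subst b(1)) (simp add: r monomial_add algebra_simps)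
  also have "\<dots> \<in> ideal_gen (polys V) (square_diffs V)"
  proof (intro ideal_gen_add ideal_gen_mult)
    show "(- 1 :: ('v, 'k) mpoly) \<in> polys V"
      using polys_1[of V] by (auto simp: polys_def)
    show "(monomial (q + q) - monomial (single i N) :: ('v, 'k) mpoly)
        \<in> ideal_gen (polys V) (square_diffs V)"
      using squares_to_power[OF qV(1) i] by (simp only: N)
    show "(monomial (q' + q') - monomial (single i N) :: ('v, 'k) mpoly)
        \<in> ideal_gen (polys V) (square_diffs V)"
      using squares_to_power[OF qV(2) i] by (simp only: N)
  qed (rule polys_monomial[OF rV])+
  finally show ?thesis .
qed


section \<open>The Eulerian ideal in terms of coefficient sums\<close>

text \<open>The exponent vector of the image under \<open>edge_hom\<close> of the monomial with exponent vector \<open>m\<close>.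
  An infinite set \<open>e\<close> contributes nothing, in agreement with the value \<open>1\<close> of infinite products,
  so that \<open>edge_mono_eq\<close> holds for all \<open>m\<close>.\<close>

definition end_exp :: "('v set \<Rightarrow>\<^sub>0 nat) \<Rightarrow> ('v \<Rightarrow>\<^sub>0 nat)" where
  "end_exp m = (\<Sum>e\<in>keys m. \<Sum>v\<in>e. single v (lookup m e))"

lemma end_exp_superset:
  assumes "finite A" "keys m \<subseteq> A"
  shows "end_exp m = (\<Sum>e\<in>A. \<Sum>v\<in>e. single v (lookup m e))"
  unfolding end_exp_def
  by (rule sum.mono_neutral_left) (use assms in \<open>auto simp: in_keys_iff\<close>)

lemma end_exp_add: "end_exp (a + b) = end_exp a + end_exp b"
  by (simp add: end_exp_superset[of "keys a \<union> keys b"] keys_add_nat lookup_add single_add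
      sum.distrib)

lemma edge_mono_eq: "edge_mono m = monomial (end_exp m)"
  by (simp add: edge_mono_def end_exp_def monomial_sum monomial_single prod_power_distrib)

lemma edge_hom_monomial: "edge_hom (monomial m) = monomial (end_exp m)"
  by (simp add: monomial_def edge_hom_single edge_mono_eq const_def)

lemma edge_hom_diff: "edge_hom (f - g) = edge_hom f - edge_hom g"
  using edge_hom_add[of "f - g" g] by simp

lemma coeff_sum_edge_hom: "coeff_sum P (edge_hom f) = coeff_sum (\<lambda>m. P (end_exp m)) f"
proof -
  have "edge_hom f = (\<Sum>m\<in>keys f. single (end_exp m) (lookup f m))"
    by (subst edge_hom_superset[of "keys f"])
      (simp_all add: edge_mono_eq const_def monomial_def mult_single)
  then show ?thesis
    by (simp add: coeff_sum_sum coeff_sum_single) (simp add: coeff_sum_def)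
qed

lemma lookup_end_exp:
  assumes "\<And>e. e \<in> keys m \<Longrightarrow> finite e"
  shows "lookup (end_exp m) v = (\<Sum>e | e \<in> keys m \<and> v \<in> e. lookup m e)"
  using assms
  by (auto simp: end_exp_def lookup_sum lookup_single when_def sum.inter_filter intro!: sum.cong)

definition edge_type :: "('v set \<Rightarrow>\<^sub>0 nat) \<Rightarrow> nat \<times> 'v set" where
  "edge_type m = parity_type (end_exp m)"

lemma edge_type_add_cancel [simp]:
  "edge_type (c + a) = edge_type (c + b) \<longleftrightarrow> edge_type a = edge_type b"
  by (simp add: edge_type_def end_exp_add)

lemma eulerian_coeff_sum_eq_0:
  "f \<in> eulerian_ideal V E \<Longrightarrow> coeff_sum (\<lambda>m. edge_type m = t) f = 0"
  using coeff_sum_parity_type_eq_0[of "edge_hom f" V t]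
  by (simp add: eulerian_ideal_def square_diffs_def coeff_sum_edge_hom edge_type_def)

locale graph =
  fixes V :: "'v set" and E :: "'v set set"
  assumes simple: "simple_graph V E"
begin

lemma edge_subset: "e \<in> E \<Longrightarrow> e \<subseteq> V"
  using simple by (auto simp: simple_graph_def)

lemma card_edge: "e \<in> E \<Longrightarrow> card e = 2"
  using simple by (auto simp: simple_graph_def)

lemma finite_edge: "e \<in> E \<Longrightarrow> finite e"
  using card_edge by (metis card.infinite zero_neq_numeral)

lemma finite_subset_edges: "J \<subseteq> E \<Longrightarrow> finite J"
  using simple by (auto simp: simple_graph_def intro!: finite_subset[of J "Pow V"])

lemma mono_degree_end_exp: "keys m \<subseteq> E \<Longrightarrow> mono_degree (end_exp m) = 2 * mono_degree m"
  unfolding end_exp_def mono_degree_sum mono_degree_single sum_constant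
  by (auto simp: mono_degree_def sum_distrib_left card_edge intro!: sum.cong)

lemma edge_type_eq_mono_degree:
  "edge_type a = edge_type b \<Longrightarrow> keys a \<subseteq> E \<Longrightarrow> keys b \<subseteq> E \<Longrightarrow> mono_degree a = mono_degree b"
  by (simp add: edge_type_def parity_type_def mono_degree_end_exp)

lemma monomial_diff_mem_eulerian_ideal:
  assumes "keys a \<subseteq> E" "keys b \<subseteq> E" "edge_type a = edge_type b"
  shows "(monomial a - monomial b :: ('v set, 'k::field) mpoly) \<in> eulerian_ideal V E"
proof -
  have "keys (end_exp m) \<subseteq> V" if "keys m \<subseteq> E" for m
  proof
    fix v assume "v \<in> keys (end_exp m)"
    then have "(\<Sum>e | e \<in> keys m \<and> v \<in> e. lookup m e) \<noteq> 0"
      using that finite_edge by (subst lookup_end_exp[symmetric]) (auto simp: in_keys_iff subset_iff)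
    then obtain e where "e \<in> keys m" "v \<in> e"
      by (metis (mono_tags, lifting) sum.neutral mem_Collect_eq)
    then show "v \<in> V" using that edge_subset by blast
  qed
  then have "(monomial (end_exp a) - monomial (end_exp b) :: ('v, 'k) mpoly)
      \<in> ideal_gen (polys V) (square_diffs V)"
    using assms by (intro monomial_diff_mem_square_diffs) (auto simp: edge_type_def)
  then show ?thesis
    using assms polys_monomial_diff
    by (auto simp: eulerian_ideal_def square_diffs_def edge_hom_diff edge_hom_monomial)
qed


section \<open>Binomials generated in lower degree\<close>

definition adjacent :: "('v set \<Rightarrow>\<^sub>0 nat) \<Rightarrow> ('v set \<Rightarrow>\<^sub>0 nat) \<Rightarrow> bool" where
  "adjacent u w \<longleftrightarrow> keys u \<subseteq> E \<and> keys w \<subseteq> E \<and> edge_type u = edge_type w \<and> keys u \<inter> keys w \<noteq> {}"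

abbreviation linked where "linked \<equiv> adjacent\<^sup>*\<^sup>*"

lemma linked_sym: "linked u w \<Longrightarrow> linked w u"
  by (rule sympD[OF symp_rtranclp]) (auto simp: symp_def adjacent_def)

lemma linked_invariants:
  assumes "linked u w" "keys u \<subseteq> E"
  shows "keys w \<subseteq> E \<and> edge_type w = edge_type u"
  using assms by (induction rule: rtranclp_induct) (auto simp: adjacent_def)

text \<open>The coefficient sum over the monomials linked to \<open>a\<close> separates \<open>a\<close> from a monomial \<open>b\<close> that is
  not linked to it, and it vanishes on the ideal.\<close>

lemma linked_if_mem_lower_ideal:
  assumes a: "keys a \<subseteq> E" "mono_degree a = d" and b: "keys b \<subseteq> E"
    and mem: "(monomial a - monomial b :: ('v set, 'k::field) mpoly)
      \<in> ideal_gen (polys E) {g \<in> eulerian_ideal V E. total_degree g < d}"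
  shows "linked a b"
proof (rule ccontr)
  assume "\<not> linked a b"
  then have "coeff_sum (linked a) (monomial a - monomial b :: ('v set, 'k) mpoly) = 1"
    by (simp add: coeff_sum_diff coeff_sum_single monomial_def)
  moreover have "coeff_sum (linked a) (monomial a - monomial b :: ('v set, 'k) mpoly) = 0"
  proof (rule coeff_sum_ideal_gen[OF mem])
    fix g :: "('v set, 'k) mpoly" and c :: "'v set \<Rightarrow>\<^sub>0 nat"
    assume g: "g \<in> {g \<in> eulerian_ideal V E. total_degree g < d}" and c: "keys c \<subseteq> E"
    have gE: "keys m \<subseteq> E" if "m \<in> keys g" for m
      using g that by (auto simp: eulerian_ideal_def polys_def)
    show "coeff_sum (\<lambda>m. linked a (c + m)) g = 0"
    proof (cases "c = 0")
      case True
      \<comment> \<open>The degree of \<open>g\<close> itself is too small for the linked monomials, which have degree \<open>d\<close>.\<close>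
      have "\<not> linked a m" if m: "m \<in> keys g" for m
      proof
        assume "linked a m"
        then have "mono_degree m = d"
          using linked_invariants a edge_type_eq_mono_degree by blast
        moreover have "mono_degree m \<le> total_degree g"
          using m by (auto simp: total_degree_def intro!: Max_ge)
        ultimately show False using g by simp
      qed
      then show ?thesis by (auto simp: coeff_sum_def True intro!: sum.neutral)
    next
      case False
      \<comment> \<open>All products \<open>c m\<close> share the variables of \<open>c\<close>, so \<open>c m\<close> and \<open>c m'\<close> are adjacent as soon
        as \<open>m\<close> and \<open>m'\<close> have the same type.\<close>
      show ?thesis
      proof (rule coeff_sum_union_of_fibres)
        show "coeff_sum (\<lambda>m. edge_type m = t) g = 0" for t
          using g eulerian_coeff_sum_eq_0 by blast
        fix m m' assume m: "m \<in> keys g" "m' \<in> keys g" "edge_type m = edge_type m'"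
          and link: "linked a (c + m)"
        obtain e where "e \<in> keys c" using False keys_eq_empty[of c] by blast
        then have "adjacent (c + m) (c + m')"
          using c m gE[OF m(1)] gE[OF m(2)] by (auto simp: adjacent_def keys_add_nat)
        with link show "linked a (c + m')" by simp
      qed
    qed
  qed
  ultimately show False by simp
qed

text \<open>Telescoping along a chain: for each link, a common variable is split off.\<close>

lemma mem_lower_ideal_if_linked:
  assumes "linked a b" "keys a \<subseteq> E" "mono_degree a = d"
  shows "(monomial a - monomial b :: ('v set, 'k::field) mpoly)
      \<in> ideal_gen (polys E) {g \<in> eulerian_ideal V E. total_degree g < d}" (is "_ \<in> ?I")
  using assms(1)
proof (induction rule: rtranclp_induct)
  case base
  show ?case by (simp add: ideal_gen_0)
next
  case (step u w)
  then obtain e where e: "e \<in> keys u" "e \<in> keys w" and u: "keys u \<subseteq> E" and w: "keys w \<subseteq> E"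
    and type: "edge_type u = edge_type w"
    by (auto simp: adjacent_def)
  obtain u' where u': "u = single e 1 + u'"
    using e(1) split_off_power[of 1 u e] by (auto simp: in_keys_iff)
  obtain w' where w': "w = single e 1 + w'"
    using e(2) split_off_power[of 1 w e] by (auto simp: in_keys_iff)
  have deg: "mono_degree u = d" "mono_degree w = d"
    using step(1) linked_invariants assms edge_type_eq_mono_degree type u w by metis+
  have "(monomial u' - monomial w' :: ('v set, 'k) mpoly) \<in> eulerian_ideal V E"
    using type u w by (intro monomial_diff_mem_eulerian_ideal) (auto simp: u' w' keys_add_nat)
  moreover have "total_degree (monomial u' - monomial w' :: ('v set, 'k) mpoly) < d"
  proof (cases "u' = w'")
    case False
    then show ?thesis
      using deg by (simp add: total_degree_def keys_monomial_diff u' w' mono_degree_add)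
  qed (use deg in \<open>simp add: total_degree_def u' mono_degree_add\<close>)
  ultimately have "var e * (monomial u' - monomial w') \<in> ?I"
    using e u by (intro ideal_gen_mult ideal_gen_generator) (auto simp: var_def intro!: polys_monomial)
  also have "var e * (monomial u' - monomial w') = (monomial u - monomial w :: ('v set, 'k) mpoly)"
    by (simp add: u' w' monomial_add var_def right_diff_distrib)
  finally have "(monomial a - monomial u) + (monomial u - monomial w :: ('v set, 'k) mpoly) \<in> ?I"
    using step.IH by (intro ideal_gen_add)
  then show ?case by simp
qed


section \<open>Exponent vectors and joins\<close>

definition odd_support :: "('v set \<Rightarrow>\<^sub>0 nat) \<Rightarrow> 'v set set" where
  "odd_support m = {e \<in> keys m. odd (lookup m e)}"

definition indicator :: "'v set set \<Rightarrow> ('v set \<Rightarrow>\<^sub>0 nat)" where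
  "indicator J = (\<Sum>e\<in>J. single e 1)"

lemma monomial_indicator: "monomial (indicator J) = edge_prod J"
  by (simp add: indicator_def edge_prod_def monomial_sum var_def)

lemma lookup_indicator: "J \<subseteq> E \<Longrightarrow> lookup (indicator J) e = (if e \<in> J then 1 else 0)"
  using finite_subset_edges[of J] by (simp add: indicator_def lookup_sum lookup_single when_def)

lemma keys_indicator: "J \<subseteq> E \<Longrightarrow> keys (indicator J) = J"
  by (auto simp: in_keys_iff lookup_indicator split: if_splits)

lemma mono_degree_indicator: "mono_degree (indicator J) = card J"
  by (simp add: indicator_def mono_degree_sum)

lemma indicator_keys:
  "keys m \<subseteq> E \<Longrightarrow> (\<And>e. lookup m e \<le> 1) \<Longrightarrow> indicator (keys m) = m"
  by (rule poly_mapping_eqI) (auto simp: lookup_indicator in_keys_iff intro: antisym)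

lemma odd_support_indicator_plus_even:
  assumes "J \<subseteq> E"
  shows "odd_support (indicator J + single h (2 * k)) = J"
  using assms by (auto simp: odd_support_def keys_add_nat keys_indicator lookup_add
      lookup_indicator lookup_single when_def)

lemma odd_support_indicator: "J \<subseteq> E \<Longrightarrow> odd_support (indicator J) = J"
  using odd_support_indicator_plus_even[of J undefined 0] by simp

lemma odd_lookup_end_exp:
  assumes "keys m \<subseteq> E"
  shows "odd (lookup (end_exp m) v) \<longleftrightarrow> odd (deg_in (odd_support m) v)"
proof -
  have "{e \<in> {e. e \<in> keys m \<and> v \<in> e}. odd (lookup m e)} = {e \<in> odd_support m. v \<in> e}"
    by (auto simp: odd_support_def)
  moreover have "finite {e. e \<in> keys m \<and> v \<in> e}" by simp
  moreover have "lookup (end_exp m) v = (\<Sum>e | e \<in> keys m \<and> v \<in> e. lookup m e)"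
    using assms finite_edge by (intro lookup_end_exp) auto
  ultimately show ?thesis
    by (simp add: even_sum_iff deg_in_def)
qed

lemma deg_in_outside: "J \<subseteq> E \<Longrightarrow> v \<notin> V \<Longrightarrow> deg_in J v = 0"
  using edge_subset by (fastforce simp: deg_in_def card_eq_0_iff)

lemma odd_support_subset: "keys m \<subseteq> E \<Longrightarrow> odd_support m \<subseteq> E"
  by (auto simp: odd_support_def)

text \<open>The type of a monomial only depends on its degree and on the edges with odd exponent, since
  even exponents do not affect the parity of any vertex degree.\<close>

lemma edge_type_eq_iff:
  assumes "keys a \<subseteq> E" "keys b \<subseteq> E"
  shows "edge_type a = edge_type b \<longleftrightarrow> mono_degree a = mono_degree b \<and>
    (\<forall>v\<in>V. odd (deg_in (odd_support a) v) \<longleftrightarrow> odd (deg_in (odd_support b) v))"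
proof -
  have "deg_in (odd_support a) v = deg_in (odd_support b) v" if "v \<notin> V" for v
    using that assms by (simp add: deg_in_outside odd_support_subset)
  then have "{v. odd (deg_in (odd_support a) v)} = {v. odd (deg_in (odd_support b) v)} \<longleftrightarrow>
      (\<forall>v\<in>V. odd (deg_in (odd_support a) v) \<longleftrightarrow> odd (deg_in (odd_support b) v))"
    unfolding set_eq_iff mem_Collect_eq by metis
  then show ?thesis
    using assms by (simp add: edge_type_def parity_type_def mono_degree_end_exp odd_lookup_end_exp)
qed

lemma of_nat_bit_eq_iff: "(of_nat a :: bit) = of_nat b \<longleftrightarrow> (even a \<longleftrightarrow> even b)"
proof -
  have "(of_nat n :: bit) = (if even n then 0 else 1)" for n
    by (induction n) auto
  then show ?thesis by simp
qed

lemma is_join_iff: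
  assumes "is_join V E T p J"
  shows "is_join V E T p L \<longleftrightarrow> L \<subseteq> E \<and> (even (card L) \<longleftrightarrow> even (card J)) \<and>
    (\<forall>v\<in>V. odd (deg_in L v) \<longleftrightarrow> odd (deg_in J v))"
  using assms by (auto simp: is_join_def of_nat_bit_eq_iff)

lemma card_odd_support:
  "card (odd_support m) = (\<Sum>e\<in>keys m. lookup m e mod 2)"
proof -
  have "card (odd_support m) = (\<Sum>e\<in>keys m. if odd (lookup m e) then 1 else 0)"
    unfolding odd_support_def card_eq_sum by (rule sum.inter_filter) simp
  then show ?thesis by (simp only: mod2_eq_if if_not_P cong: if_cong) (auto intro!: sum.cong)
qed

text \<open>The edges with odd exponent in a monomial of the type of \<open>J\<close> form a join of the same kind,
  with fewer edges than the degree unless the monomial is squarefree.  Conversely, a smaller join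
  \<open>L\<close> has the same parity of cardinality, and multiplying its monomial by an even power of a
  variable gives a monomial of the type of \<open>J\<close> which is not squarefree.\<close>

lemma min_join_iff_squarefree:
  assumes J: "is_join V E T p J"
  shows "J \<in> min_joins V E T p \<longleftrightarrow>
    (\<forall>m e. keys m \<subseteq> E \<longrightarrow> edge_type m = edge_type (indicator J) \<longrightarrow> lookup m e \<le> 1)"
    (is "_ \<longleftrightarrow> ?squarefree")
proof
  have JE: "J \<subseteq> E" using J by (simp add: is_join_def)
  show ?squarefree if min: "J \<in> min_joins V E T p"
  proof (intro allI impI, rule ccontr)
    fix m e assume m: "keys m \<subseteq> E" "edge_type m = edge_type (indicator J)" and "\<not> lookup m e \<le> 1"
    then have e: "e \<in> keys m" "lookup m e mod 2 < lookup m e" by (auto simp: in_keys_iff)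
    have deg: "mono_degree m = card J"
      "\<forall>v\<in>V. odd (deg_in (odd_support m) v) \<longleftrightarrow> odd (deg_in J v)"
      using m JE by (auto simp: edge_type_eq_iff keys_indicator mono_degree_indicator odd_support_indicator)
    have "even (card (odd_support m)) \<longleftrightarrow> even (mono_degree m)"
      unfolding card_odd_support mono_degree_def by (simp add: even_sum_iff)
    then have "is_join V E T p (odd_support m)"
      using deg m odd_support_subset by (simp add: is_join_iff[OF J])
    moreover have "card (odd_support m) < mono_degree m"
      unfolding card_odd_support mono_degree_def
      using e by (intro sum_strict_mono_ex1) auto
    ultimately show False using min deg(1) by (force simp: min_joins_def)
  qed
  show "J \<in> min_joins V E T p" if squarefree: ?squarefree
  proof (rule ccontr)
    assume "J \<notin> min_joins V E T p"
    then obtain L where L: "is_join V E T p L" "card L < card J"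
      using J by (auto simp: min_joins_def not_le)
    then have LE: "L \<subseteq> E" by (simp add: is_join_def)
    obtain h where h: "h \<in> J" using L(2) by fastforce
    have "even (card L) \<longleftrightarrow> even (card J)" using L(1) is_join_iff[OF J] by blast
    then have "even (card J - card L)" using L(2) by simp
    then obtain k where k: "card J = card L + 2 * k" using L(2)
      by (metis dvdE le_add_diff_inverse less_imp_le)
    have "keys (indicator L + single h (2 * k)) \<subseteq> E"
      using h JE LE by (auto simp: keys_add_nat keys_indicator split: if_splits)
    moreover from this have "edge_type (indicator L + single h (2 * k)) = edge_type (indicator J)"
      using JE LE k L(1)
      by (auto simp: edge_type_eq_iff keys_indicator mono_degree_add mono_degree_indicator
          odd_support_indicator odd_support_indicator_plus_even is_join_iff[OF J])
    ultimately have "lookup (indicator L + single h (2 * k)) h \<le> 1"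
      using squarefree by blast
    then show False using k L(2) by (simp add: lookup_add)
  qed
qed

text \<open>Thus the squarefree monomials of the type of a minimum join are the minimum joins of the
  same kind.\<close>

lemma min_joins_edge_type:
  assumes "J \<in> min_joins V E T p"
  shows "K \<in> min_joins V E T p \<longleftrightarrow> K \<subseteq> E \<and> edge_type (indicator K) = edge_type (indicator J)"
proof
  have J: "is_join V E T p J" "J \<subseteq> E" and minJ: "\<And>L. is_join V E T p L \<Longrightarrow> card J \<le> card L"
    using assms by (auto simp: min_joins_def is_join_def)
  show "K \<subseteq> E \<and> edge_type (indicator K) = edge_type (indicator J)" if "K \<in> min_joins V E T p"
  proof -
    have K: "is_join V E T p K" and "card K = card J"
      using that J(1) minJ by (auto simp: min_joins_def intro: antisym)
    then show ?thesis
      using J(2) by (auto simp: is_join_iff[OF J(1)] edge_type_eq_iff keys_indicator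
          mono_degree_indicator odd_support_indicator)
  qed
  show "K \<in> min_joins V E T p" if "K \<subseteq> E \<and> edge_type (indicator K) = edge_type (indicator J)"
    using that J minJ by (auto simp: is_join_iff[OF J(1)] edge_type_eq_iff keys_indicator
          mono_degree_indicator odd_support_indicator min_joins_def)
qed

text \<open>Chains indexed by numbers become a reflexive transitive closure; membership of \<open>J\<close> is needed
  for the chain of length zero, which satisfies the right-hand side for every \<open>J\<close>.\<close>

lemma join_equiv_rtranclp:
  assumes "J \<in> min_joins V E T p"
  shows "join_equiv V E T p J K \<longleftrightarrow>
    (\<lambda>A B. A \<in> min_joins V E T p \<and> B \<in> min_joins V E T p \<and> A \<inter> B \<noteq> {})\<^sup>*\<^sup>* J K"
    (is "_ \<longleftrightarrow> ?meets\<^sup>*\<^sup>* J K")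
proof
  assume "join_equiv V E T p J K"
  then obtain r :: nat and L where "\<forall>i\<le>r. L i \<in> min_joins V E T p" "L 0 = J" "L r = K"
    "\<forall>i<r. L i \<inter> L (Suc i) \<noteq> {}"
    unfolding join_equiv_def by blast
  then have "(?meets ^^ r) J K"
    unfolding relpowp_fun_conv by (intro exI[of _ L]) auto
  then show "?meets\<^sup>*\<^sup>* J K" by (rule relpowp_imp_rtranclp)
next
  assume "?meets\<^sup>*\<^sup>* J K"
  then obtain r where "(?meets ^^ r) J K" by (auto dest: rtranclp_imp_relpowp)
  then obtain L where L: "L 0 = J" "L r = K" "\<forall>i<r. ?meets (L i) (L (Suc i))"
    unfolding relpowp_fun_conv by blast
  have "L i \<in> min_joins V E T p" if "i \<le> r" for i
    using that L(1,3) assms by (cases i) auto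
  then show "join_equiv V E T p J K"
    unfolding join_equiv_def using L by (intro exI[of _ r] exI[of _ L]) auto
qed

text \<open>A chain of adjacent monomials that starts at a minimum join cannot leave the squarefree
  monomials, so it consists of minimum joins that meet successively.\<close>

lemma linked_indicators_iff:
  assumes J: "J \<in> min_joins V E T p" and K: "K \<in> min_joins V E T p"
  shows "linked (indicator J) (indicator K) \<longleftrightarrow> join_equiv V E T p J K"
proof -
  define M where "M = min_joins V E T p"
  define meets where "meets A B \<longleftrightarrow> A \<in> M \<and> B \<in> M \<and> A \<inter> B \<noteq> {}" for A B
  have ME: "A \<in> M \<Longrightarrow> A \<subseteq> E" for A by (auto simp: M_def min_joins_def is_join_def)
  have "linked (indicator J) (indicator K)" if "meets\<^sup>*\<^sup>* J K"
    using that
  proof (induction rule: rtranclp_induct)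
    case (step A B)
    then have "adjacent (indicator A) (indicator B)"
      using min_joins_edge_type[of A T p B] ME
      by (auto simp: adjacent_def meets_def keys_indicator M_def)
    with step.IH show ?case by simp
  qed simp
  moreover have "m = indicator (keys m) \<and> keys m \<in> M \<and> meets\<^sup>*\<^sup>* J (keys m)"
    if "linked (indicator J) m" for m
    using that
  proof (induction rule: rtranclp_induct)
    case base
    then show ?case using J ME by (simp add: keys_indicator M_def)
  next
    case (step u w)
    have "linked (indicator J) w"
      using step(1,2) by (rule rtranclp.rtrancl_into_rtrancl)
    then have w: "keys w \<subseteq> E" "edge_type w = edge_type (indicator J)"
      using linked_invariants[of "indicator J" w] J ME by (auto simp: keys_indicator M_def)
    have "is_join V E T p J" using J by (simp add: min_joins_def)
    then have "indicator (keys w) = w"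
      using J w by (intro indicator_keys) (auto simp: min_join_iff_squarefree)
    moreover from this have "keys w \<in> M"
      using min_joins_edge_type[OF J] w by (simp add: M_def)
    ultimately show ?case
      using step by (auto simp: adjacent_def meets_def intro: rtranclp.rtrancl_into_rtrancl)
  qed
  ultimately have "linked (indicator J) (indicator K) \<longleftrightarrow> meets\<^sup>*\<^sup>* J K"
    using ME K keys_indicator[of K] by (metis M_def)
  then show ?thesis
    unfolding join_equiv_rtranclp[OF J] meets_def[abs_def] M_def .
qed


section \<open>Classification of the unlinked pairs\<close>

lemma edge_type_double:
  assumes "e \<in> E" "l \<in> E"
  shows "edge_type (single e 2) = edge_type (single l 2)"
proof -
  have "odd_support (single h 2) = {}" for h by (auto simp: odd_support_def lookup_single when_def)
  then show ?thesis using assms by (simp add: edge_type_eq_iff)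
qed

text \<open>Two different edges of a simple graph have different sets of endpoints, so a product of two
  different edge variables has a vertex of odd degree.\<close>

lemma edge_type_double_imp:
  assumes "keys m \<subseteq> E" "e \<in> E" "edge_type m = edge_type (single e 2)"
  obtains h where "h \<in> E" "m = single h 2"
proof -
  have deg: "mono_degree m = 2" using assms edge_type_eq_mono_degree[of m "single e 2"] by simp
  have split: "\<exists>h m'. m = single h 1 + m'" if "mono_degree m \<noteq> 0" for m :: "'v set \<Rightarrow>\<^sub>0 nat"
  proof -
    from that obtain h where "h \<in> keys m" by (rule obtain_key)
    then have "1 \<le> lookup m h" by (simp add: in_keys_iff)
    then show ?thesis by (rule split_off_power) blast
  qed
  obtain h m' where m': "m = single h 1 + m'" using split[of m] unfolding deg by auto
  have "mono_degree m' = 1" using deg unfolding m' mono_degree_add by simp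
  then obtain l m'' where m'': "m' = single l 1 + m''" using split[of m'] by auto
  have "m'' = 0"
    using \<open>mono_degree m' = 1\<close> unfolding m'' mono_degree_add by (simp add: mono_degree_eq_0_iff)
  then have m: "m = single h 1 + single l 1" unfolding m' m'' by simp
  then have E: "h \<in> E" "l \<in> E" using assms(1) by (auto simp: keys_add_nat)
  have "h = l"
  proof (rule ccontr)
    assume "h \<noteq> l"
    then have "odd_support m = {h, l}"
      by (auto simp: m odd_support_def keys_add_nat lookup_add lookup_single when_def)
    moreover have "odd_support (single e 2) = {}"
      by (auto simp: odd_support_def lookup_single when_def)
    ultimately have even: "\<forall>v\<in>V. even (deg_in {h, l} v)"
      using assms by (simp add: edge_type_eq_iff deg_in_def)
    have "\<not> h \<subseteq> l"
      using E \<open>h \<noteq> l\<close> card_subset_eq[of l h] by (auto simp: card_edge finite_edge)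
    then obtain v where v: "v \<in> h" "v \<notin> l" by blast
    then have "{e \<in> {h, l}. v \<in> e} = {h}" by auto
    then have "deg_in {h, l} v = 1" by (simp add: deg_in_def)
    moreover have "v \<in> V" using v(1) E(1) edge_subset by blast
    ultimately show False using even by fastforce
  qed
  then have "m = single h 2"
    unfolding m by (simp only: single_add[symmetric] one_add_one)
  with E show thesis using that by blast
qed

text \<open>The intermediate monomial in the chain is \<open>t\<^sub>l\<^sup>2 g\<close> for an edge \<open>l\<close> in the support of \<open>u\<close>: it
  shares \<open>l\<close> with \<open>u\<close>, and \<open>g\<close> with the target.\<close>

lemma linked_to_double_plus:
  assumes "h \<in> E" "keys g \<subseteq> E" "g \<noteq> 0" "keys u \<subseteq> E" "edge_type u = edge_type (single h 2 + g)"
  shows "linked u (single h 2 + g)"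
proof -
  have "mono_degree u \<noteq> 0"
    using edge_type_eq_mono_degree[OF assms(5)] assms by (simp add: keys_add_nat mono_degree_add)
  then obtain l where l: "l \<in> keys u" by (rule obtain_key)
  then have lE: "l \<in> E" using assms by auto
  have type: "edge_type (single l 2 + g) = edge_type (single h 2 + g)"
    using edge_type_double[OF lE assms(1)] by (simp add: add.commute[of _ g])
  have "adjacent u (single l 2 + g)"
    using assms l lE type by (auto simp: adjacent_def keys_add_nat)
  moreover obtain x where "x \<in> keys g" using assms(3) keys_eq_empty[of g] by blast
  then have "adjacent (single l 2 + g) (single h 2 + g)"
    using assms lE type by (auto simp: adjacent_def keys_add_nat)
  ultimately show ?thesis by (meson converse_rtranclp_into_rtranclp r_into_rtranclp)
qed

text \<open>Either all monomials of the type are squarefree, and then they are minimum joins, or there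
  is one of the form \<open>t\<^sub>e\<^sup>2 g\<close>; in that case \<open>g\<close> must be trivial, since otherwise both \<open>a\<close> and \<open>b\<close>
  would be linked to it.\<close>

lemma not_linked_cases:
  assumes a: "keys a \<subseteq> E" and b: "keys b \<subseteq> E" and type: "edge_type a = edge_type b"
    and "\<not> linked a b"
  shows "(\<exists>e\<in>E. \<exists>l\<in>E. a = single e 2 \<and> b = single l 2) \<or>
    (\<exists>T p J K. J \<in> min_joins V E T p \<and> K \<in> min_joins V E T p \<and> \<not> join_equiv V E T p J K \<and>
      a = indicator J \<and> b = indicator K)"
proof (cases "\<forall>m e. keys m \<subseteq> E \<longrightarrow> edge_type m = edge_type a \<longrightarrow> lookup m e \<le> 1")
  case True
  define T where "T = {v \<in> V. odd (deg_in (keys a) v)}"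
  define p :: bit where "p = of_nat (card (keys a))"
  have ind: "indicator (keys a) = a" "indicator (keys b) = b"
    using True[rule_format, OF a refl] True[rule_format, OF b type[symmetric]]
      indicator_keys[OF a] indicator_keys[OF b] by blast+
  have "is_join V E T p (keys a)" using a by (simp add: is_join_def T_def p_def)
  from min_join_iff_squarefree[OF this] have J: "keys a \<in> min_joins V E T p"
    using True by (simp only: ind)
  have K: "keys b \<in> min_joins V E T p"
    using b type by (simp only: min_joins_edge_type[OF J] ind)
  have "\<not> join_equiv V E T p (keys a) (keys b)"
    using assms(4) linked_indicators_iff[OF J K] unfolding ind by blast
  with J K show ?thesis
    using ind[symmetric]
    by (intro disjI2 exI[of _ T] exI[of _ p] exI[of _ "keys a"] exI[of _ "keys b"] conjI)
next
  case False
  then obtain m e where m: "keys m \<subseteq> E" "edge_type m = edge_type a" and "\<not> lookup m e \<le> 1"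
    by blast
  then have "2 \<le> lookup m e" by simp
  then obtain g where g: "m = single e 2 + g" by (rule split_off_power)
  then have eg: "e \<in> E" "keys g \<subseteq> E" using m(1) by (auto simp: keys_add_nat)
  have "g = 0"
  proof (rule ccontr)
    assume "g \<noteq> 0"
    have am: "linked a m"
      unfolding g by (rule linked_to_double_plus[OF eg \<open>g \<noteq> 0\<close> a m(2)[symmetric, unfolded g]])
    have bm: "linked b m"
      unfolding g
      by (rule linked_to_double_plus[OF eg \<open>g \<noteq> 0\<close> b
            trans[OF type[symmetric] m(2)[symmetric, unfolded g]]])
    show False
      using assms(4) rtranclp_trans[OF am linked_sym[OF bm]] ..
  qed
  then have "m = single e 2" by (simp add: g)
  then have doubles: "edge_type a = edge_type (single e 2)" "edge_type b = edge_type (single e 2)"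
    using m(2) type by simp_all
  obtain h where "h \<in> E" "a = single h 2"
    by (rule edge_type_double_imp[OF a eg(1) doubles(1)])
  moreover obtain l where "l \<in> E" "b = single l 2"
    by (rule edge_type_double_imp[OF b eg(1) doubles(2)])
  ultimately show ?thesis by blast
qed

text \<open>Only squares of variables have the type of such a square, and two of them share a variable
  only if they are equal.\<close>

lemma not_linked_doubles:
  assumes "e \<in> E" "e \<noteq> l"
  shows "\<not> linked (single e 2) (single l 2)"
proof
  assume "linked (single e 2) (single l 2)"
  moreover have "m = single e 2" if "linked (single e 2) m" for m
    using that
  proof (induction rule: rtranclp_induct)
    case (step u w)
    then have w: "keys w \<subseteq> E" "edge_type w = edge_type (single e 2)" "keys w \<inter> {e} \<noteq> {}"
      by (auto simp: adjacent_def)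
    then obtain h where "w = single h 2" using edge_type_double_imp assms(1) by metis
    with w show ?case by simp
  qed simp
  ultimately have "(single l 2 :: 'v set \<Rightarrow>\<^sub>0 nat) = single e 2" by blast
  then have "lookup (single l 2) e = (2 :: nat)" by simp
  then show False using assms(2) by (simp add: lookup_single)
qed

end

theorem theorem3p3:
  fixes n d :: nat and V :: "nat set" and E :: "nat set set"
    and f :: "(nat set, 'k::field) mpoly"
  assumes "V = {1..n}" and "simple_graph V E" and "card E \<ge> 2"
    and "f \<in> eulerian_ideal V E" and "f \<noteq> 0" and "binomial_in E f" and "homogeneous d f"
  shows "f \<notin> ideal_gen (polys E) {g \<in> eulerian_ideal V E. total_degree g < d} \<longleftrightarrow>
    (\<exists>e\<in>E. \<exists>l\<in>E. f = var e ^ 2 - var l ^ 2) \<or>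
    (\<exists>T p J K. (T, p) \<in> join_types V E \<and> J \<in> min_joins V E T p \<and> K \<in> min_joins V E T p \<and>
       \<not> join_equiv V E T p J K \<and> f = edge_prod J - edge_prod K)"
proof -
  interpret graph V E by (unfold_locales) (rule assms(2))
  have degrees: "a \<noteq> b \<and> mono_degree a = d \<and> mono_degree b = d"
    if "f = monomial a - monomial b" for a b
    using assms(5,7) that keys_monomial_diff[of a b, where 'k = 'k]
    by (cases "a = b") (auto simp: homogeneous_def)
  have mem_iff:
    "f \<in> ideal_gen (polys E) {g \<in> eulerian_ideal V E. total_degree g < d} \<longleftrightarrow> linked a b"
    if f: "f = monomial a - monomial b" and "keys a \<subseteq> E" "keys b \<subseteq> E" for a b
    using linked_if_mem_lower_ideal[of a d b] mem_lower_ideal_if_linked[of a b d] that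
      degrees[OF f] by blast
  obtain a b where a: "keys a \<subseteq> E" and b: "keys b \<subseteq> E" and f: "f = monomial a - monomial b"
    using assms(6) by (auto simp: binomial_in_def)
  have type: "edge_type a = edge_type b"
    using eulerian_coeff_sum_eq_0[OF assms(4), of "edge_type a"]
    by (auto simp: f monomial_def coeff_sum_diff coeff_sum_single split: if_splits)
  show ?thesis
  proof
    assume "f \<notin> ideal_gen (polys E) {g \<in> eulerian_ideal V E. total_degree g < d}"
    then have "\<not> linked a b" using mem_iff[OF f a b] by simp
    from not_linked_cases[OF a b type this]
    show "(\<exists>e\<in>E. \<exists>l\<in>E. f = var e ^ 2 - var l ^ 2) \<or>
      (\<exists>T p J K. (T, p) \<in> join_types V E \<and> J \<in> min_joins V E T p \<and> K \<in> min_joins V E T p \<and>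
       \<not> join_equiv V E T p J K \<and> f = edge_prod J - edge_prod K)"
    proof (elim disjE bexE exE conjE)
      fix e l assume "e \<in> E" "l \<in> E" "a = single e 2" "b = single l 2"
      then show ?thesis using f by (auto simp: monomial_single)
    next
      fix T p J K
      assume J: "J \<in> min_joins V E T p" and rest: "K \<in> min_joins V E T p" "\<not> join_equiv V E T p J K"
        "a = indicator J" "b = indicator K"
      have "(T, p) \<in> join_types V E"
        using J by (auto simp: join_types_def min_joins_def is_join_def)
      moreover have "f = edge_prod J - edge_prod K" using rest f by (simp add: monomial_indicator)
      ultimately show ?thesis using J rest by blast
    qed
  next
    assume "(\<exists>e\<in>E. \<exists>l\<in>E. f = var e ^ 2 - var l ^ 2) \<or>
      (\<exists>T p J K. (T, p) \<in> join_types V E \<and> J \<in> min_joins V E T p \<and> K \<in> min_joins V E T p \<and>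
       \<not> join_equiv V E T p J K \<and> f = edge_prod J - edge_prod K)"
    then show "f \<notin> ideal_gen (polys E) {g \<in> eulerian_ideal V E. total_degree g < d}"
    proof (elim disjE bexE exE conjE)
      fix e l assume el: "e \<in> E" "l \<in> E" and "f = var e ^ 2 - var l ^ 2"
      then have f': "f = monomial (single e 2) - monomial (single l 2)"
        by (simp add: monomial_single)
      then have "e \<noteq> l" using assms(5) by auto
      then show ?thesis using mem_iff[OF f'] el not_linked_doubles by auto
    next
      fix T p J K
      assume JK: "J \<in> min_joins V E T p" "K \<in> min_joins V E T p" "\<not> join_equiv V E T p J K"
        and "f = edge_prod J - edge_prod K"
      then have f': "f = monomial (indicator J) - monomial (indicator K)"
        by (simp add: monomial_indicator)
      have "J \<subseteq> E" "K \<subseteq> E" using JK by (auto simp: min_joins_def is_join_def)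
      then show ?thesis
        using mem_iff[OF f'] JK linked_indicators_iff by (auto simp: keys_indicator)
    qed
  qed
qed

end
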